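(* Let $\alpha>0$, $\rho>0$ and $0\le a<b$. Let $f:[a^\rho,b^\rho]\to\mathbb{R}$ be a positive function with $f\in X^p_c(a^\rho,b^\rho)$. If $f$ is convex on $[a^\rho,b^\rho]$, then $$ f\left(\frac{a^{\rho}+b^{\rho}}{2}\right)\leq \frac{\rho^\alpha \Gamma(\alpha+1)}{2(b^\rho-a^\rho)^\alpha}\left[ {}^\rho I^\alpha_{a+}f(b^{\rho})+ {}^\rho I^\alpha_{b-}f(a^{\rho})\right] \leq \frac{f(a^{\rho})+f(b^{\rho})}{2}. $$
   Context: The left- and right-sided Katugampola fractional integrals of order $\alpha>0$ with parameter $\rho>0$ of a function $h$ on $[a,b]$ are $$ {}^\rho I^\alpha_{a+}h(x)=\frac{\rho^{1-\alpha}}{\Gamma(\alpha)}\int_a^x\frac{t^{\rho-1}}{(x^\rho-t^\rho)^{1-\alpha}}h(t)\,dt,\qquad {}^\rho I^\alpha_{b-}h(x)=\frac{\rho^{1-\alpha}}{\Gamma(\alpha)}\int_x^b\frac{t^{\rho-1}}{(t^\rho-x^\rho)^{1-\alpha}}h(t)\,dt,$$ when the integrals exist. For $f$ defined on $[a^\rho,b^\rho]$, the notation ${}^\rho I^\alpha_{a+}f(b^\rho)$ means the left-sided integral of the function $h(x)=f(x^\rho)$ on $[a,b]$ evaluated at $x=b$, i.e. $\frac{\rho^{1-\alpha}}{\Gamma(\alpha)}\int_a^b\frac{t^{\rho-1}}{(b^\rho-t^\rho)^{1-\alpha}}f(t^\rho)\,dt$, and ${}^\rho I^\alpha_{b-}f(a^\rho)$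 means the right-sided integral of the same function evaluated at $x=a$, i.e. $\frac{\rho^{1-\alpha}}{\Gamma(\alpha)}\int_a^b\frac{t^{\rho-1}}{(t^\rho-a^\rho)^{1-\alpha}}f(t^\rho)\,dt$. $\Gamma$ is Euler's gamma function. For $c\in\mathbb{R}$ and $1\le p\le\infty$ (here fixed but arbitrary), $X^p_c(A,B)$ is the space of Lebesgue measurable functions $h$ on $(A,B)$ with $\left(\int_A^B|t^c h(t)|^p\frac{dt}{t}\right)^{1/p}<\infty$ (for $p=\infty$: $\operatorname{ess\,sup}_{A\le t\le B}|t^c h(t)|<\infty$). *)

theory Defs
  imports "HOL-Probability.Essential_Supremum" "HOL-Analysis.Analysis"
begin

definition katugampola_left_integrand ::
  "real \<Rightarrow> real \<Rightarrow> (real \<Rightarrow> real) \<Rightarrow> real \<Rightarrow> real \<Rightarrow> real" where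
  "katugampola_left_integrand \<rho> \<alpha> h x t =
     t powr (\<rho> - 1) / (x powr \<rho> - t powr \<rho>) powr (1 - \<alpha>) * h t"

definition katugampola_right_integrand ::
  "real \<Rightarrow> real \<Rightarrow> (real \<Rightarrow> real) \<Rightarrow> real \<Rightarrow> real \<Rightarrow> real" where
  "katugampola_right_integrand \<rho> \<alpha> h x t =
     t powr (\<rho> - 1) / (t powr \<rho> - x powr \<rho>) powr (1 - \<alpha>) * h t"

text \<open>
  The integrals are Lebesgue integrals.  The integrands may be singular at \<open>t = x\<close> and at \<open>t = 0\<close>;
  the values that HOL's conventions \<open>y / 0 = 0\<close> and \<open>0 powr y = 0\<close> assign there are
  immaterial, as these points form a null set.  Since the Bochner integral of a non-integrable
  function is \<open>0\<close> by convention, existence is recorded by separate predicates.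
\<close>

definition katugampola_left_exists ::
  "real \<Rightarrow> real \<Rightarrow> real \<Rightarrow> (real \<Rightarrow> real) \<Rightarrow> real \<Rightarrow> bool" where
  "katugampola_left_exists \<rho> \<alpha> a h x \<longleftrightarrow>
     set_integrable lebesgue {a..x} (katugampola_left_integrand \<rho> \<alpha> h x)"

definition katugampola_right_exists ::
  "real \<Rightarrow> real \<Rightarrow> real \<Rightarrow> (real \<Rightarrow> real) \<Rightarrow> real \<Rightarrow> bool" where
  "katugampola_right_exists \<rho> \<alpha> b h x \<longleftrightarrow>
     set_integrable lebesgue {x..b} (katugampola_right_integrand \<rho> \<alpha> h x)"

definition katugampola_left ::
  "real \<Rightarrow> real \<Rightarrow> real \<Rightarrow> (real \<Rightarrow> real) \<Rightarrow> real \<Rightarrow> real" where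
  "katugampola_left \<rho> \<alpha> a h x =
     \<rho> powr (1 - \<alpha>) / Gamma \<alpha> *
       (LINT t:{a..x}|lebesgue. katugampola_left_integrand \<rho> \<alpha> h x t)"

definition katugampola_right ::
  "real \<Rightarrow> real \<Rightarrow> real \<Rightarrow> (real \<Rightarrow> real) \<Rightarrow> real \<Rightarrow> real" where
  "katugampola_right \<rho> \<alpha> b h x =
     \<rho> powr (1 - \<alpha>) / Gamma \<alpha> *
       (LINT t:{x..b}|lebesgue. katugampola_right_integrand \<rho> \<alpha> h x t)"

text \<open>
  The space \<open>X\<^sup>p\<^sub>c(A,B)\<close> for \<open>0 \<le> A\<close> and \<open>1 \<le> p \<le> \<infinity>\<close>.  For finite \<open>p\<close> the outer exponent
  \<open>1/p\<close> of the norm is dropped, since it does not affect finiteness.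
\<close>

definition X_space :: "ereal \<Rightarrow> real \<Rightarrow> real \<Rightarrow> real \<Rightarrow> (real \<Rightarrow> real) set" where
  "X_space p c A B =
     {h \<in> borel_measurable (lebesgue_on {A<..<B}).
        if p = \<infinity>
        then esssup (lebesgue_on {A<..<B}) (\<lambda>t. ereal \<bar>t powr c * h t\<bar>) < \<infinity>
        else (\<integral>\<^sup>+ t. ennreal (\<bar>t powr c * h t\<bar> powr real_of_ereal p / t)
                \<partial>lebesgue_on {A<..<B}) < \<infinity>}"

end

theory Submission
  imports Defs
begin

text \<open>
  With \<open>A = a\<^sup>\<rho>\<close> and \<open>B = b\<^sup>\<rho>\<close>, the substitution \<open>u = t\<^sup>\<rho>\<close> turns the two Katugampola integrals into
  Riemann--Liouville integrals over \<open>(A, B)\<close> with kernels \<open>(B - u)\<^sup>\<alpha>\<^sup>-\<^sup>1\<close> and \<open>(u - A)\<^sup>\<alpha>\<^sup>-\<^sup>1\<close>.  Reflecting the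
  first one by \<open>u \<mapsto> A + B - u\<close>, their sum is the integral of \<open>f u + f (A + B - u)\<close> against
  \<open>(u - A)\<^sup>\<alpha>\<^sup>-\<^sup>1\<close>.  Convexity places \<open>f u + f (A + B - u)\<close> between \<open>2 f ((A + B) / 2)\<close> and
  \<open>f A + f B\<close>, and the kernel has total mass \<open>(B - A)\<^sup>\<alpha> / \<alpha>\<close>.
\<close>

lemma absolutely_integrable_reflect_interval:
  fixes g :: "real \<Rightarrow> real"
  assumes "g absolutely_integrable_on {A<..<B}"
  shows "(\<lambda>u. g (A + B - u)) absolutely_integrable_on {A<..<B}"
    and "integral {A<..<B} (\<lambda>u. g (A + B - u)) = integral {A<..<B} g"
proof -
  let ?r = "\<lambda>u. A + B - u"
  have img: "?r ` {A<..<B} = {A<..<B}"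
    by (auto intro!: image_eqI[where x = "A + B - x" for x])
  \<comment> \<open>The factor \<open>\<bar>-1\<bar>\<close> is the Jacobian of the reflection,
    spelled out to match the change of variables rule.\<close>
  have "(\<lambda>u. \<bar>-1\<bar> * g (?r u)) absolutely_integrable_on {A<..<B} \<and>
      integral {A<..<B} (\<lambda>u. \<bar>-1\<bar> * g (?r u)) = integral {A<..<B} g
    \<longleftrightarrow> g absolutely_integrable_on (?r ` {A<..<B}) \<and>
      integral (?r ` {A<..<B}) g = integral {A<..<B} g"
    by (rule has_absolute_integral_change_of_variables_1')
      (auto intro!: derivative_eq_intros inj_onI)
  then show "(\<lambda>u. g (A + B - u)) absolutely_integrable_on {A<..<B}"
    and "integral {A<..<B} (\<lambda>u. g (A + B - u)) = integral {A<..<B} g"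
    using assms unfolding img by simp_all
qed

lemma powr_image_greaterThanLessThan:
  fixes a b \<rho> :: real
  assumes "0 \<le> a" and "0 \<le> b" and "\<rho> > 0"
  shows "(\<lambda>t. t powr \<rho>) ` {a<..<b} = {a powr \<rho><..<b powr \<rho>}"
proof (rule set_eqI, rule iffI)
  fix u
  assume "u \<in> (\<lambda>t. t powr \<rho>) ` {a<..<b}"
  then show "u \<in> {a powr \<rho><..<b powr \<rho>}"
    using assms by (auto intro!: powr_less_mono2)
next
  fix u
  assume u: "u \<in> {a powr \<rho><..<b powr \<rho>}"
  then have "u > 0"
    using powr_ge_zero[of a \<rho>] by (simp del: powr_ge_zero)
  then have eq: "(u powr (1 / \<rho>)) powr \<rho> = u"
    using assms by (simp add: powr_powr)
  have "a < u powr (1 / \<rho>)"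
  proof (rule ccontr)
    assume "\<not> a < u powr (1 / \<rho>)"
    then have "(u powr (1 / \<rho>)) powr \<rho> \<le> a powr \<rho>"
      using assms by (intro powr_mono2) auto
    then show False using u eq by simp
  qed
  moreover have "u powr (1 / \<rho>) < b"
  proof (rule ccontr)
    assume "\<not> u powr (1 / \<rho>) < b"
    then have "b powr \<rho> \<le> (u powr (1 / \<rho>)) powr \<rho>"
      using assms by (intro powr_mono2) auto
    then show False using u eq by simp
  qed
  ultimately show "u \<in> (\<lambda>t. t powr \<rho>) ` {a<..<b}"
    using eq by (intro image_eqI[where x = "u powr (1 / \<rho>)"]) auto
qed

text \<open>Change of variables needs a derivative at every point, and \<open>t powr \<rho>\<close>
  may lack one at \<open>0\<close> when \<open>a = 0\<close>. It is therefore applied on the open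
  interval, and the null set of endpoints is added afterwards. The division by \<open>\<rho>\<close>
  removes the constant of the Jacobian \<open>\<rho> * t powr (\<rho> - 1)\<close>.\<close>

lemma absolutely_integrable_powr_substitution:
  fixes F :: "real \<Rightarrow> real"
  assumes "0 \<le> a" and "0 \<le> b" and "\<rho> > 0"
    and F: "F absolutely_integrable_on {a powr \<rho><..<b powr \<rho>}"
  shows "(\<lambda>t. t powr (\<rho> - 1) * F (t powr \<rho>)) absolutely_integrable_on {a..b}"
    and "integral {a..b} (\<lambda>t. t powr (\<rho> - 1) * F (t powr \<rho>))
      = integral {a powr \<rho><..<b powr \<rho>} F / \<rho>"
proof -
  let ?h = "\<lambda>t. t powr (\<rho> - 1) * F (t powr \<rho>)"
  let ?I = "integral {a powr \<rho><..<b powr \<rho>} F"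
  note img = powr_image_greaterThanLessThan[OF \<open>0 \<le> a\<close> \<open>0 \<le> b\<close> \<open>\<rho> > 0\<close>]
  have "inj_on (\<lambda>t. t powr \<rho>) {a<..<b}"
    using assms by (intro strict_mono_on_imp_inj_on strict_mono_onI powr_less_mono2) auto
  then have "(\<lambda>t. \<bar>\<rho> * t powr (\<rho> - 1)\<bar> * F (t powr \<rho>)) absolutely_integrable_on {a<..<b} \<and>
      integral {a<..<b} (\<lambda>t. \<bar>\<rho> * t powr (\<rho> - 1)\<bar> * F (t powr \<rho>)) = ?I
    \<longleftrightarrow> F absolutely_integrable_on ((\<lambda>t. t powr \<rho>) ` {a<..<b}) \<and>
      integral ((\<lambda>t. t powr \<rho>) ` {a<..<b}) F = ?I"
    using assms
    by (intro has_absolute_integral_change_of_variables_1')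
      (auto intro!: has_field_derivative_at_within[OF has_real_derivative_powr])
  moreover have "(\<lambda>t. \<bar>\<rho> * t powr (\<rho> - 1)\<bar> * F (t powr \<rho>)) = (\<lambda>t. \<rho> * ?h t)"
    using assms by (simp add: abs_mult mult.assoc)
  ultimately have int: "(\<lambda>t. \<rho> * ?h t) absolutely_integrable_on {a<..<b}"
    and val: "integral {a<..<b} (\<lambda>t. \<rho> * ?h t) = ?I"
    using F unfolding img by simp_all
  have open_int: "?h absolutely_integrable_on {a<..<b}"
    using set_integrable_mult_right[of "1 / \<rho>", OF int] \<open>\<rho> > 0\<close> by simp
  show "?h absolutely_integrable_on {a..b}"
    by (rule absolutely_integrable_spike_set[OF open_int]; rule negligible_subset[of "{a, b}"]) auto
  show "integral {a..b} ?h = ?I / \<rho>"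
    unfolding integral_open_interval_real using val \<open>\<rho> > 0\<close>
    by (simp add: field_simps)
qed

text \<open>The kernel is unbounded at \<open>A\<close> when \<open>\<alpha> < 1\<close>, but its
  antiderivative \<open>(u - A) powr \<alpha> / \<alpha>\<close> is continuous up to
  \<open>A\<close> because \<open>\<alpha> > 0\<close>. So the fundamental theorem with derivatives
  only in the interior applies, and nonnegativity upgrades integrability to absolute
  integrability.\<close>

lemma powr_kernel_integral:
  fixes A B \<alpha> :: real
  assumes "\<alpha> > 0" and "A \<le> B"
  shows "(\<lambda>u. (u - A) powr (\<alpha> - 1)) absolutely_integrable_on {A<..<B}"
    and "integral {A<..<B} (\<lambda>u. (u - A) powr (\<alpha> - 1)) = (B - A) powr \<alpha> / \<alpha>"
proof -
  let ?w = "\<lambda>u. (u - A) powr (\<alpha> - 1)"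
  have "(?w has_integral ((B - A) powr \<alpha> / \<alpha> - (A - A) powr \<alpha> / \<alpha>)) {A..B}"
  proof (rule fundamental_theorem_of_calculus_interior)
    show "continuous_on {A..B} (\<lambda>u. (u - A) powr \<alpha> / \<alpha>)"
      using assms by (auto intro!: continuous_intros continuous_on_powr')
    show "((\<lambda>u. (u - A) powr \<alpha> / \<alpha>) has_vector_derivative ?w u) (at u)"
      if "u \<in> {A<..<B}" for u
      using that assms unfolding has_real_derivative_iff_has_vector_derivative[symmetric]
      by (auto intro!: derivative_eq_intros)
  qed fact
  then have "(?w has_integral (B - A) powr \<alpha> / \<alpha>) {A<..<B}"
    using has_integral_open_interval[of ?w _ A B] by simp
  then show "?w absolutely_integrable_on {A<..<B}"
    and "integral {A<..<B} ?w = (B - A) powr \<alpha> / \<alpha>"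
    by (auto intro!: nonnegative_absolutely_integrable_1 intro: integral_unique)
qed

text \<open>The points \<open>u\<close> and \<open>A + B - u\<close> have midpoint
  \<open>(A + B) / 2\<close>, which gives the lower bound. For the upper one, reflection swaps the
  weights \<open>1 - s\<close> and \<open>s\<close> of the endpoints, so in the sum of the two chord
  bounds \<open>s\<close> cancels.\<close>

lemma convex_on_reflect_bounds:
  fixes f :: "real \<Rightarrow> real"
  assumes f: "convex_on {A..B} f" and u: "u \<in> {A..B}"
  shows "2 * f ((A + B) / 2) \<le> f u + f (A + B - u)"
    and "f u + f (A + B - u) \<le> f A + f B"
proof -
  have "f ((1 - 1/2) *\<^sub>R u + (1/2) *\<^sub>R (A + B - u)) \<le> (1 - 1/2) * f u + (1/2) * f (A + B - u)"
    using u by (intro convex_onD[OF f]) auto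
  moreover have "(1 - 1/2) *\<^sub>R u + (1/2) *\<^sub>R (A + B - u) = (A + B) / 2"
    by (simp add: field_simps)
  ultimately have "f ((A + B) / 2) \<le> (1 - 1/2) * f u + (1/2) * f (A + B - u)"
    by metis
  then show "2 * f ((A + B) / 2) \<le> f u + f (A + B - u)"
    by simp
  show "f u + f (A + B - u) \<le> f A + f B"
  proof (cases "A = B")
    case True
    then show ?thesis using u by simp
  next
    case False
    define s where "s = (u - A) / (B - A)"
    have s: "0 \<le> s" "s \<le> 1" "s * (B - A) = u - A"
      using u False by (auto simp: s_def field_simps)
    have "f ((1 - s) *\<^sub>R A + s *\<^sub>R B) \<le> (1 - s) * f A + s * f B"
      and "f ((1 - s) *\<^sub>R B + s *\<^sub>R A) \<le> (1 - s) * f B + s * f A"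
      using u s by (intro convex_onD[OF f]; simp)+
    moreover have "(1 - s) *\<^sub>R A + s *\<^sub>R B = u" and "(1 - s) *\<^sub>R B + s *\<^sub>R A = A + B - u"
      using s(3) by (auto simp: algebra_simps)
    ultimately have "f u \<le> (1 - s) * f A + s * f B" and "f (A + B - u) \<le> (1 - s) * f B + s * f A"
      by simp_all
    then show ?thesis by (simp add: algebra_simps)
  qed
qed

text \<open>A Fejer-type inequality: \<open>f\<close> is symmetrised instead of the weight, so the
  pointwise bounds can be multiplied by \<open>w\<close> and integrated.\<close>

lemma weighted_hermite_hadamard:
  fixes f w :: "real \<Rightarrow> real"
  assumes f: "convex_on {A..B} f"
    and w: "w integrable_on {A<..<B}" "\<And>u. u \<in> {A<..<B} \<Longrightarrow> 0 \<le> w u"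
    and wf: "(\<lambda>u. w u * (f u + f (A + B - u))) integrable_on {A<..<B}"
  shows "2 * f ((A + B) / 2) * integral {A<..<B} w
      \<le> integral {A<..<B} (\<lambda>u. w u * (f u + f (A + B - u)))"
    and "integral {A<..<B} (\<lambda>u. w u * (f u + f (A + B - u)))
      \<le> (f A + f B) * integral {A<..<B} w"
proof -
  have "integral {A<..<B} (\<lambda>u. w u * (2 * f ((A + B) / 2)))
      \<le> integral {A<..<B} (\<lambda>u. w u * (f u + f (A + B - u)))"
    using w convex_on_reflect_bounds(1)[OF f]
    by (intro integral_le wf integrable_on_mult_left) (auto intro: mult_left_mono)
  then show "2 * f ((A + B) / 2) * integral {A<..<B} w
      \<le> integral {A<..<B} (\<lambda>u. w u * (f u + f (A + B - u)))"
    by (simp add: mult.commute)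
  have "integral {A<..<B} (\<lambda>u. w u * (f u + f (A + B - u)))
      \<le> integral {A<..<B} (\<lambda>u. w u * (f A + f B))"
    using w convex_on_reflect_bounds(2)[OF f]
    by (intro integral_le wf integrable_on_mult_left) (auto intro: mult_left_mono)
  then show "integral {A<..<B} (\<lambda>u. w u * (f u + f (A + B - u)))
      \<le> (f A + f B) * integral {A<..<B} w"
    by (simp add: mult.commute)
qed

theorem theorem2p1:
  fixes \<alpha> \<rho> a b c :: real and p :: ereal and f :: "real \<Rightarrow> real"
  assumes "\<alpha> > 0" and "\<rho> > 0" and "0 \<le> a" and "a < b"
    and "1 \<le> p"
    and "\<And>x. x \<in> {a powr \<rho>..b powr \<rho>} \<Longrightarrow> f x > 0"
    and "f \<in> X_space p c (a powr \<rho>) (b powr \<rho>)"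
    and "convex_on {a powr \<rho>..b powr \<rho>} f"
  shows "katugampola_left_exists \<rho> \<alpha> a (\<lambda>x. f (x powr \<rho>)) b
    \<and> katugampola_right_exists \<rho> \<alpha> b (\<lambda>x. f (x powr \<rho>)) a
    \<and> f ((a powr \<rho> + b powr \<rho>) / 2)
        \<le> \<rho> powr \<alpha> * Gamma (\<alpha> + 1) / (2 * (b powr \<rho> - a powr \<rho>) powr \<alpha>)
           * (katugampola_left \<rho> \<alpha> a (\<lambda>x. f (x powr \<rho>)) b
              + katugampola_right \<rho> \<alpha> b (\<lambda>x. f (x powr \<rho>)) a)
    \<and> \<rho> powr \<alpha> * Gamma (\<alpha> + 1) / (2 * (b powr \<rho> - a powr \<rho>) powr \<alpha>)
           * (katugampola_left \<rho> \<alpha> a (\<lambda>x. f (x powr \<rho>)) b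
              + katugampola_right \<rho> \<alpha> b (\<lambda>x. f (x powr \<rho>)) a)
        \<le> (f (a powr \<rho>) + f (b powr \<rho>)) / 2"
proof -
  define A where "A = a powr \<rho>"
  define B where "B = b powr \<rho>"
  define w where "w u = (u - A) powr (\<alpha> - 1)" for u
  define h where "h x = f (x powr \<rho>)" for x
  note assms' = assms[folded A_def B_def]
  have AB: "A < B"
    using assms by (auto simp: A_def B_def intro!: powr_less_mono2)
  have b: "0 \<le> b" using assms by simp
  have w_int: "w absolutely_integrable_on {A<..<B}"
    and w_mass: "integral {A<..<B} w = (B - A) powr \<alpha> / \<alpha>"
    using powr_kernel_integral[OF \<open>\<alpha> > 0\<close>, of A B] AB unfolding w_def by simp_all
  have f_meas: "f \<in> borel_measurable (lebesgue_on {A<..<B})"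
    using assms'(7) by (simp add: X_space_def)
  have f_bdd: "bounded (f ` {A<..<B})"
  proof -
    \<comment> \<open>Positivity at \<open>A + B - u\<close> lets that term be dropped from the
      chord bound, and positivity at \<open>u\<close> removes the absolute value. Boundedness then
      makes the product with a singular but integrable kernel integrable.\<close>
    have "\<bar>f u\<bar> \<le> f A + f B" if "u \<in> {A<..<B}" for u
      using convex_on_reflect_bounds(2)[OF assms'(8), of u]
        assms'(6)[of u] assms'(6)[of "A + B - u"] that by simp
    then show ?thesis by (auto simp: bounded_iff intro!: exI[of _ "f A + f B"])
  qed
  have fR: "(\<lambda>u. f u * w u) absolutely_integrable_on {A<..<B}"
    by (rule absolutely_integrable_bounded_measurable_product_real[OF f_meas _ f_bdd w_int]) simp
  \<comment> \<open>Here \<open>w (A + B - u)\<close> is the left-sided kernel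
    \<open>(B - u) powr (\<alpha> - 1)\<close>.\<close>
  have fL: "(\<lambda>u. f u * w (A + B - u)) absolutely_integrable_on {A<..<B}"
    by (rule absolutely_integrable_bounded_measurable_product_real[OF f_meas _ f_bdd
          absolutely_integrable_reflect_interval(1)[OF w_int]]) simp
  note fL' = absolutely_integrable_reflect_interval[OF fL]
  note subL = absolutely_integrable_powr_substitution[OF \<open>0 \<le> a\<close> b \<open>\<rho> > 0\<close> fL[unfolded A_def B_def],
      folded A_def B_def]
  note subR = absolutely_integrable_powr_substitution[OF \<open>0 \<le> a\<close> b \<open>\<rho> > 0\<close> fR[unfolded A_def B_def],
      folded A_def B_def]
  \<comment> \<open>At \<open>y = 0\<close> both sides are \<open>0\<close> by convention, so
    \<open>L\<close> and \<open>R\<close> below are equalities of functions, including at the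
    singular points.\<close>
  have powr_neg: "x / y powr (1 - \<alpha>) * z = x * (z * y powr (\<alpha> - 1))" for x y z :: real
    using powr_minus_divide[of y "1 - \<alpha>"] by simp
  have L: "katugampola_left_integrand \<rho> \<alpha> h b
      = (\<lambda>t. t powr (\<rho> - 1) * (f (t powr \<rho>) * w (A + B - t powr \<rho>)))"
    unfolding katugampola_left_integrand_def powr_neg w_def h_def B_def by auto
  have R: "katugampola_right_integrand \<rho> \<alpha> h a
      = (\<lambda>t. t powr (\<rho> - 1) * (f (t powr \<rho>) * w (t powr \<rho>)))"
    unfolding katugampola_right_integrand_def powr_neg w_def h_def A_def by auto
  have exL: "katugampola_left_exists \<rho> \<alpha> a h b"
    unfolding katugampola_left_exists_def L by (rule subL(1))
  have exR: "katugampola_right_exists \<rho> \<alpha> b h a"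
    unfolding katugampola_right_exists_def R by (rule subR(1))

  define S where "S = integral {A<..<B} (\<lambda>u. w u * (f u + f (A + B - u)))"
  have int: "(\<lambda>u. f u * w u) integrable_on {A<..<B}"
    "(\<lambda>u. f (A + B - u) * w u) integrable_on {A<..<B}"
    using set_lebesgue_integral_eq_integral(1)[OF fR]
      set_lebesgue_integral_eq_integral(1)[OF fL'(1)] by simp_all
  have split: "(\<lambda>u. w u * (f u + f (A + B - u))) = (\<lambda>u. f u * w u + f (A + B - u) * w u)"
    by (auto simp: algebra_simps)
  \<comment> \<open>Reflection moves the \<open>f (A + B - u)\<close> part of \<open>S\<close> onto
    the left-sided kernel.\<close>
  have S_split: "S = integral {A<..<B} (\<lambda>u. f u * w u)
      + integral {A<..<B} (\<lambda>u. f u * w (A + B - u))"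
    unfolding S_def split using fL'(2) by (simp add: integral_add[OF int])
  have sum: "katugampola_left \<rho> \<alpha> a h b + katugampola_right \<rho> \<alpha> b h a
      = \<rho> powr (1 - \<alpha>) / Gamma \<alpha> * (S / \<rho>)"
    unfolding katugampola_left_def katugampola_right_def L R
      set_lebesgue_integral_eq_integral(2)[OF subL(1)]
      set_lebesgue_integral_eq_integral(2)[OF subR(1)] subL(2) subR(2) S_split
    by (simp add: algebra_simps add_divide_distrib)
  \<comment> \<open>This cancels the \<open>1 / \<rho>\<close> from the substitution; the Gamma
    quotient leaves the factor \<open>\<alpha>\<close>.\<close>
  have "\<rho> powr \<alpha> * \<rho> powr (1 - \<alpha>) = \<rho>"
    using \<open>\<rho> > 0\<close> by (simp flip: powr_add)
  have "Gamma (\<alpha> + 1) = \<alpha> * Gamma \<alpha>" and "Gamma \<alpha> > 0"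
    using \<open>\<alpha> > 0\<close> by (auto intro!: Gamma_plus1)
  then have "\<rho> powr \<alpha> * Gamma (\<alpha> + 1) * (\<rho> powr (1 - \<alpha>) / Gamma \<alpha> * (S / \<rho>))
      = (\<rho> powr \<alpha> * \<rho> powr (1 - \<alpha>)) * (\<alpha> * S) / \<rho>"
    by simp
  also have "\<dots> = \<alpha> * S"
    using \<open>\<rho> powr \<alpha> * \<rho> powr (1 - \<alpha>) = \<rho>\<close> \<open>\<rho> > 0\<close> by simp
  finally have val: "\<rho> powr \<alpha> * Gamma (\<alpha> + 1) / (2 * (B - A) powr \<alpha>)
      * (katugampola_left \<rho> \<alpha> a h b + katugampola_right \<rho> \<alpha> b h a)
      = \<alpha> * S / (2 * (B - A) powr \<alpha>)"
    unfolding sum by (simp only: times_divide_eq_left)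
  have "w integrable_on {A<..<B}"
    using w_int by (rule set_lebesgue_integral_eq_integral(1))
  moreover have "(\<lambda>u. w u * (f u + f (A + B - u))) integrable_on {A<..<B}"
    unfolding split by (rule integrable_add[OF int])
  ultimately have bounds: "2 * f ((A + B) / 2) * ((B - A) powr \<alpha> / \<alpha>) \<le> S"
    "S \<le> (f A + f B) * ((B - A) powr \<alpha> / \<alpha>)"
    using weighted_hermite_hadamard[OF assms'(8), of w] unfolding S_def w_mass
    by (simp_all add: w_def)
  \<comment> \<open>Both bounds are divided by twice the mass of the kernel,
    \<open>2 * (B - A) powr \<alpha> / \<alpha>\<close>.\<close>
  have "(B - A) powr \<alpha> > 0" using AB by simp
  then have "f ((A + B) / 2) \<le> \<alpha> * S / (2 * (B - A) powr \<alpha>)"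
    and "\<alpha> * S / (2 * (B - A) powr \<alpha>) \<le> (f A + f B) / 2"
    using bounds \<open>\<alpha> > 0\<close> by (simp_all add: field_simps)
  then show ?thesis
    using exL exR val unfolding A_def B_def h_def[abs_def] by (simp only: simp_thms)
qed

end
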